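(* Let $\phi>0$, $\mu\in\mathbb{R}$, $\sigma>0$, and let $Y$ be a random variable with characteristic function $$\psi_Y(t)=\exp\left[-\phi\left\{b(\xi_0)-b\left[\xi_0+\phi^{-1}\left(it\mu-\frac{t^2\sigma^2}{2}\right)\right]\right\}\right],\qquad t\in\mathbb{R}.$$ Then $$Y\overset{d}{=}\mu W_\phi+\sigma\sqrt{W_\phi}\,Z,$$ where $W_\phi\sim\mathrm{EF}(\phi)$ and $Z\sim N(0,1)$ are independent, and $\overset{d}{=}$ denotes equality in distribution.
   Context: Exponential family $\mathrm{EF}(\phi)$: $W_\phi$ is a strictly positive continuous random variable whose density with respect to a $\sigma$-finite measure $\nu$ is $$f_{W_\phi}(w)=\exp\{\phi[w\xi_0-b(\xi_0)]+c(w;\phi)\},\qquad w>0,\ \phi>0,$$ where $c:\mathbb{R}^+\times\mathbb{R}^+\to\mathbb{R}$, $b$ is continuous and three times differentiable, and $\xi_0$ is such that $b'(\xi_0)=1$. Here $b$ is the cumulant function of the exponential family: for every $\phi>0$ and every $\theta$ in an open interval $\Theta\supseteq(-\infty,\xi_0]$, the function $w\mapsto\exp\{\phi[w\theta-b(\theta)]+c(w;\phi)\}$ is a probability density with respect to $\nu$ on $(0,\infty)$. In particular $E(W_\phi)=b'(\xi_0)=1$ and $\mathrm{Var}(W_\phi)=\phi^{-1}b''(\xi_0)$. At complex arguments, $b$ denotes its analytic extension to $\{z\in\mathbb{C}:\mathrm{Re}\,z\in\Theta\}$. *)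

theory Defs
  imports "HOL-Probability.Probability"
begin

definition prob_density :: "real measure \<Rightarrow> (real \<Rightarrow> real) \<Rightarrow> bool" where
  "prob_density \<nu> f \<longleftrightarrow>
     f \<in> borel_measurable \<nu> \<and> (\<forall>w. 0 \<le> f w) \<and> (\<integral>\<^sup>+ w. ennreal (f w) \<partial>\<nu>) = 1"

text \<open>The density is supported on the positive half-line, so the values of \<open>c w \<phi>\<close> matter
  only for \<open>w > 0\<close> (and \<open>\<phi> > 0\<close>).\<close>

definition EF_density ::
    "(real \<Rightarrow> real) \<Rightarrow> (real \<Rightarrow> real \<Rightarrow> real) \<Rightarrow> real \<Rightarrow> real \<Rightarrow> real \<Rightarrow> real" where
  "EF_density b c \<phi> \<theta> w =
     (if 0 < w then exp (\<phi> * (w * \<theta> - b \<theta>) + c w \<phi>) else 0)"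

locale EF_family = sigma_finite_measure \<nu>
  for \<nu> :: "real measure" +
  fixes b :: "real \<Rightarrow> real" and c :: "real \<Rightarrow> real \<Rightarrow> real"
    and \<Theta> :: "real set" and \<xi>0 :: real
  assumes sets_nu: "sets \<nu> = sets borel"
    and Theta_open_interval: "open \<Theta>" "is_interval \<Theta>"
    and Theta_left: "{..\<xi>0} \<subseteq> \<Theta>"
    and b_continuous: "continuous_on \<Theta> b"
    and b_differentiable: "\<And>k. k < 3 \<Longrightarrow> (deriv ^^ k) b differentiable_on \<Theta>"
    and deriv_b_xi0: "deriv b \<xi>0 = 1"
    and cumulant: "\<And>\<phi> \<theta>. \<phi> > 0 \<Longrightarrow> \<theta> \<in> \<Theta> \<Longrightarrow> prob_density \<nu> (EF_density b c \<phi> \<theta>)"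

text \<open>Since \<open>\<Theta>\<close> is an open interval, the strip is connected and such a \<open>B\<close> is
  uniquely determined on the strip by \<open>b\<close>.\<close>

definition analytic_extension ::
    "(real \<Rightarrow> real) \<Rightarrow> real set \<Rightarrow> (complex \<Rightarrow> complex) \<Rightarrow> bool" where
  "analytic_extension b \<Theta> B \<longleftrightarrow>
     B analytic_on {z. Re z \<in> \<Theta>} \<and> (\<forall>\<theta>\<in>\<Theta>. B (complex_of_real \<theta>) = complex_of_real (b \<theta>))"

text \<open>\<open>W \<sim> EF(\<phi>)\<close> on the probability space \<open>N\<close>. Because the density refers to a general
  \<open>\<sigma>\<close>-finite \<open>\<nu>\<close>, ``continuous'' is read as: the law of \<open>W\<close> has no atoms. Almost sure
  positivity already follows from the form of the density.\<close>

definition EF_distributed ::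
    "'a measure \<Rightarrow> ('a \<Rightarrow> real) \<Rightarrow> real measure \<Rightarrow> (real \<Rightarrow> real) \<Rightarrow> (real \<Rightarrow> real \<Rightarrow> real)
       \<Rightarrow> real \<Rightarrow> real \<Rightarrow> bool" where
  "EF_distributed N W \<nu> b c \<xi>0 \<phi> \<longleftrightarrow>
     (AE x in N. 0 < W x) \<and>
     (\<forall>w. measure (distr N borel W) {w} = 0) \<and>
     distributed N \<nu> W (\<lambda>w. ennreal (EF_density b c \<phi> \<xi>0 w))"

end

theory Submission
  imports Defs "HOL-Complex_Analysis.Complex_Analysis"
begin

text \<open>Conditioning on \<open>W\<close>, the characteristic function of \<open>\<mu> W + \<sigma> \<surd>W Z\<close> at \<open>t\<close> is the
  moment generating function of \<open>W\<close> at the complex point \<open>i t \<mu> - t\<^sup>2 \<sigma>\<^sup>2 / 2\<close>. On the real axis the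
  normalisation of the tilted densities determines the moment generating function of \<open>W\<close> in terms
  of \<open>b\<close>; both sides are holomorphic on the strip over \<open>\<Theta>\<close>, so the identity persists there, and
  the point lies over \<open>{..\<xi>0}\<close> after rescaling. Levy's uniqueness theorem concludes.\<close>

section \<open>Differentiation of complex moment generating functions under the integral\<close>

lemma norm_exp_minus_one_le:
  fixes z :: complex
  shows "norm (exp z - 1) \<le> norm z * exp (norm z)"
proof -
  have "norm (exp z - 1) \<le> exp \<bar>Re z\<bar> * norm z"
    using Taylor_exp[of z 0] by simp
  also have "\<dots> \<le> exp (norm z) * norm z"
    by (intro mult_right_mono) (auto simp: abs_Re_le_cmod)
  finally show ?thesis by (simp add: mult.commute)
qed

text \<open>The bound is uniform in \<open>h\<close>, so it can serve as the dominating function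
  below. After \<open>exp (s * w)\<close> is factored out, the linear factor
  \<open>\<bar>w\<bar>\<close> is absorbed into \<open>exp (r * \<bar>w\<bar>) / r\<close>, which
  doubles the exponent. Replacing \<open>exp (2 * r * \<bar>w\<bar>)\<close> by the sum over both
  signs leaves only real exponentials of linear functions of \<open>w\<close>.\<close>

lemma norm_exp_difference_quotient_le:
  fixes h s :: complex and r w :: real
  assumes "0 < r" "norm h \<le> r"
  shows "norm ((exp ((s + h) * of_real w) - exp (s * of_real w)) / h)
           \<le> (exp ((Re s + 2 * r) * w) + exp ((Re s - 2 * r) * w)) / r"
proof (cases "h = 0")
  \<comment> \<open>Division by zero yields 0, so the left-hand side vanishes.\<close>
  case True
  then show ?thesis using assms by simp
next
  case False
  have "norm (exp (h * of_real w) - 1) \<le> norm h * \<bar>w\<bar> * exp (norm h * \<bar>w\<bar>)"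
    using norm_exp_minus_one_le[of "h * of_real w"] by (simp add: norm_mult)
  also have "\<dots> \<le> norm h * \<bar>w\<bar> * exp (r * \<bar>w\<bar>)"
    using assms by (intro mult_left_mono) (auto intro: mult_right_mono)
  also have "\<dots> \<le> norm h * (exp (r * \<bar>w\<bar>) / r) * exp (r * \<bar>w\<bar>)"
  proof (intro mult_right_mono mult_left_mono)
    have "r * \<bar>w\<bar> \<le> exp (r * \<bar>w\<bar>)"
      using exp_ge_add_one_self[of "r * \<bar>w\<bar>"] by linarith
    then show "\<bar>w\<bar> \<le> exp (r * \<bar>w\<bar>) / r"
      using assms by (simp add: field_simps)
  qed auto
  also have "\<dots> = norm h * (exp (2 * r * \<bar>w\<bar>) / r)"
    by (simp only: mult_2 distrib_right exp_add) simp
  also have "\<dots> \<le> norm h * ((exp (2 * r * w) + exp (- (2 * r * w))) / r)"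
    using assms by (intro mult_left_mono divide_right_mono) (auto simp: abs_if)
  finally have bound: "norm (exp (h * of_real w) - 1)
      \<le> norm h * ((exp (2 * r * w) + exp (- (2 * r * w))) / r)" .
  have "norm ((exp ((s + h) * of_real w) - exp (s * of_real w)) / h)
      = exp (Re s * w) * (norm (exp (h * of_real w) - 1) / norm h)"
  proof -
    have "exp ((s + h) * of_real w) - exp (s * of_real w)
        = exp (s * of_real w) * (exp (h * of_real w) - 1)"
      by (simp add: distrib_right exp_add right_diff_distrib)
    then show ?thesis by (simp add: norm_mult norm_divide)
  qed
  also have "\<dots> \<le> exp (Re s * w) * ((exp (2 * r * w) + exp (- (2 * r * w))) / r)"
    using bound False by (intro mult_left_mono) (simp_all add: divide_le_eq mult.commute)
  also have "\<dots> = (exp ((Re s + 2 * r) * w) + exp ((Re s - 2 * r) * w)) / r"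
    by (simp add: distrib_left distrib_right left_diff_distrib exp_add exp_diff exp_minus
        divide_inverse)
  finally show ?thesis .
qed

text \<open>Since \<open>exp (s * w)\<close> has norm \<open>exp (Re s * w)\<close>, integrability
  at real exponents covers the whole strip. Openness of \<open>I\<close> leaves room on both sides
  of \<open>Re s\<close> for an integrable bound on the difference quotients, and dominated
  convergence gives the derivative.\<close>

lemma holomorphic_on_complex_mgf:
  fixes M :: "real measure" and I :: "real set"
  assumes sets_M: "sets M = sets borel" and I: "open I"
    and int: "\<And>x. x \<in> I \<Longrightarrow> integrable M (\<lambda>w. exp (x * w))"
  shows "(\<lambda>s. CLINT w|M. exp (s * of_real w)) holomorphic_on {s. Re s \<in> I}"
proof -
  note [measurable_cong] = sets_M
  let ?F = "\<lambda>s. CLINT w|M. exp (s * complex_of_real w)"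
  have int_exp: "integrable M (\<lambda>w. exp (s * complex_of_real w))" if "Re s \<in> I" for s
    by (rule Bochner_Integration.integrable_bound[OF int[OF that]]) auto
  have "\<exists>D. (?F has_field_derivative D) (at s)" if s: "Re s \<in> I" for s
  proof -
    obtain e where e: "0 < e" "\<And>y. dist y (Re s) < e \<Longrightarrow> y \<in> I"
      using I s unfolding open_dist by blast
    \<comment> \<open>With this choice \<open>2 * r\<close> is below \<open>e\<close>, so both
      exponents \<open>Re s + 2 * r\<close> and \<open>Re s - 2 * r\<close> of the dominating
      function lie in \<open>I\<close>.\<close>
    define r where "r = e / 4"
    have r: "0 < r" using e by (simp add: r_def)
    have near: "y \<in> I" if "\<bar>y - Re s\<bar> \<le> 2 * r" for y
      using that e by (intro e(2)) (auto simp: dist_real_def r_def)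
    have "((\<lambda>h. (?F (s + h) - ?F s) / h) \<longlongrightarrow> (CLINT w|M. of_real w * exp (s * of_real w))) (at 0)"
      unfolding tendsto_at_iff_sequentially
    proof safe
      fix X :: "nat \<Rightarrow> complex"
      assume X: "\<forall>i. X i \<in> UNIV - {0}" and X0: "X \<longlonglongrightarrow> 0"
      have "\<forall>\<^sub>F i in sequentially. norm (X i) < r"
        using tendstoD[OF X0 r] by simp
      \<comment> \<open>Dropping the first \<open>k\<close> terms makes the domination hold at every
        index; \<open>LIMSEQ_offset\<close> undoes the shift at the end.\<close>
      then obtain k where k: "\<And>i. norm (X (i + k)) < r"
        by (auto simp: eventually_sequentially) (metis le_add2)
      define u where "u i w = (exp ((s + X (i + k)) * of_real w) - exp (s * of_real w)) / X (i + k)"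
        for i and w :: real
      have "(\<lambda>i. integral\<^sup>L M (u i)) \<longlonglongrightarrow> (CLINT w|M. of_real w * exp (s * of_real w))"
      proof (rule integral_dominated_convergence
          [where w = "\<lambda>w. (exp ((Re s + 2 * r) * w) + exp ((Re s - 2 * r) * w)) / r"])
        show "integrable M (\<lambda>w. (exp ((Re s + 2 * r) * w) + exp ((Re s - 2 * r) * w)) / r)"
          using r by (intro integrable_divide Bochner_Integration.integrable_add int near) auto
        show "AE w in M. norm (u i w)
            \<le> (exp ((Re s + 2 * r) * w) + exp ((Re s - 2 * r) * w)) / r" for i
          unfolding u_def using k[of i] r
          by (intro AE_I2 norm_exp_difference_quotient_le) auto
        show "AE w in M. (\<lambda>i. u i w) \<longlonglongrightarrow> of_real w * exp (s * of_real w)"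
        proof (rule AE_I2)
          fix w :: real
          have "((\<lambda>z. exp (z * of_real w)) has_field_derivative of_real w * exp (s * of_real w)) (at s)"
            by (auto intro!: derivative_eq_intros)
          then have "((\<lambda>h. (exp ((s + h) * of_real w) - exp (s * of_real w)) / h)
              \<longlongrightarrow> of_real w * exp (s * of_real w)) (at 0)"
            by (simp add: DERIV_def)
          moreover have "filterlim (\<lambda>i. X (i + k)) (at 0) sequentially"
            using X X0 by (auto simp: filterlim_at intro: LIMSEQ_ignore_initial_segment)
          ultimately show "(\<lambda>i. u i w) \<longlonglongrightarrow> of_real w * exp (s * of_real w)"
            unfolding u_def by (rule filterlim_compose)
        qed
      qed (auto simp: u_def[abs_def])
      moreover have "integral\<^sup>L M (u i) = (?F (s + X (i + k)) - ?F s) / X (i + k)" for i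
      proof -
        have "Re (s + X (i + k)) \<in> I"
          using k[of i] abs_Re_le_cmod[of "X (i + k)"] by (intro near) auto
        then show ?thesis
          unfolding u_def using int_exp s by simp
      qed
      ultimately have "(\<lambda>i. (?F (s + X (i + k)) - ?F s) / X (i + k))
          \<longlonglongrightarrow> (CLINT w|M. of_real w * exp (s * of_real w))"
        by simp
      then show "((\<lambda>h. (?F (s + h) - ?F s) / h) \<circ> X)
          \<longlonglongrightarrow> (CLINT w|M. of_real w * exp (s * of_real w))"
        unfolding comp_def by (rule LIMSEQ_offset)
    qed
    then show ?thesis
      unfolding DERIV_def by blast
  qed
  then show ?thesis
    unfolding holomorphic_on_def field_differentiable_def
    by (blast intro: has_field_derivative_at_within)
qed

section \<open>Moment generating function of the exponential family\<close>

lemma EF_density_nonneg: "0 \<le> EF_density b c \<phi> \<theta> w"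
  by (simp add: EF_density_def)

context EF_family
begin

text \<open>Exponential tilting: multiplying the density at \<open>\<xi>0\<close> by this
  exponential gives a constant multiple of the density at \<open>\<theta>\<close>. The latter
  integrates to 1, so the constant is the integral.\<close>

lemma tilted_EF_density_has_integral:
  assumes phi: "\<phi> > 0" and \<theta>: "\<theta> \<in> \<Theta>"
  shows "has_bochner_integral (density \<nu> (\<lambda>w. ennreal (EF_density b c \<phi> \<xi>0 w)))
           (\<lambda>w. exp (\<phi> * (\<theta> - \<xi>0) * w)) (exp (\<phi> * (b \<theta> - b \<xi>0)))"
proof (rule has_bochner_integral_nn_integral)
  note [measurable_cong] = sets_nu
  have "\<xi>0 \<in> \<Theta>" using Theta_left by auto
  then have [measurable]: "EF_density b c \<phi> \<xi>0 \<in> borel_measurable \<nu>"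
    and [measurable]: "EF_density b c \<phi> \<theta> \<in> borel_measurable \<nu>"
    and one: "(\<integral>\<^sup>+ w. ennreal (EF_density b c \<phi> \<theta> w) \<partial>\<nu>) = 1"
    using cumulant[OF phi] \<theta> unfolding prob_density_def by auto
  have tilt: "EF_density b c \<phi> \<xi>0 w * exp (\<phi> * (\<theta> - \<xi>0) * w)
      = exp (\<phi> * (b \<theta> - b \<xi>0)) * EF_density b c \<phi> \<theta> w" for w
    by (auto simp: EF_density_def algebra_simps simp flip: exp_add)
  have "(\<integral>\<^sup>+ w. ennreal (exp (\<phi> * (\<theta> - \<xi>0) * w))
          \<partial>density \<nu> (\<lambda>w. ennreal (EF_density b c \<phi> \<xi>0 w)))
      = (\<integral>\<^sup>+ w. ennreal (EF_density b c \<phi> \<xi>0 w * exp (\<phi> * (\<theta> - \<xi>0) * w)) \<partial>\<nu>)"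
    by (subst nn_integral_density) (auto simp: EF_density_nonneg ennreal_mult)
  also have "\<dots> = ennreal (exp (\<phi> * (b \<theta> - b \<xi>0)))"
    unfolding tilt
    by (subst ennreal_mult) (auto simp: EF_density_nonneg nn_integral_cmult one)
  finally show "(\<integral>\<^sup>+ w. ennreal (exp (\<phi> * (\<theta> - \<xi>0) * w))
          \<partial>density \<nu> (\<lambda>w. ennreal (EF_density b c \<phi> \<xi>0 w))) = ennreal (exp (\<phi> * (b \<theta> - b \<xi>0)))" .
  show "(\<lambda>w. exp (\<phi> * (\<theta> - \<xi>0) * w))
      \<in> borel_measurable (density \<nu> (\<lambda>w. ennreal (EF_density b c \<phi> \<xi>0 w)))"
    by measurable
qed auto

text \<open>Both sides are holomorphic in \<open>z\<close> on the strip over \<open>\<Theta>\<close>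
  and agree on its real points by tilting, so the identity theorem applies.\<close>

lemma complex_mgf_eq:
  assumes B: "analytic_extension b \<Theta> B" and phi: "\<phi> > 0" and z: "Re z \<in> \<Theta>"
  shows "(CLINT w|density \<nu> (\<lambda>w. ennreal (EF_density b c \<phi> \<xi>0 w)).
            exp (complex_of_real \<phi> * (z - of_real \<xi>0) * of_real w))
         = exp (of_real \<phi> * (B z - B (of_real \<xi>0)))"
proof -
  define m where "m = density \<nu> (\<lambda>w. ennreal (EF_density b c \<phi> \<xi>0 w))"
  define G where "G s = (CLINT w|m. exp (s * complex_of_real w))" for s
  define S where "S = {z. Re z \<in> \<Theta>}"
  note real_mgf = tilted_EF_density_has_integral[OF phi, folded m_def]
  \<comment> \<open>These are the real exponents \<open>x = \<phi> * (\<theta> - \<xi>0)\<close>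
    with \<open>\<theta>\<close> in \<open>\<Theta>\<close>, exactly those at which tilting gives
    integrability.\<close>
  define I where "I = (\<lambda>x. \<xi>0 + x / \<phi>) -` \<Theta>"
  have "G holomorphic_on {s. Re s \<in> I}"
    unfolding G_def
  proof (rule holomorphic_on_complex_mgf)
    show "sets m = sets borel" by (simp add: m_def sets_nu)
    show "open I"
      unfolding I_def using Theta_open_interval(1)
      by (intro open_vimage continuous_intros) (use phi in auto)
    show "integrable m (\<lambda>w. exp (x * w))" if "x \<in> I" for x
      using integrable.intros[OF real_mgf[of "\<xi>0 + x / \<phi>"]] that phi
      by (simp add: I_def)
  qed
  moreover have "(\<lambda>z. complex_of_real \<phi> * (z - of_real \<xi>0)) holomorphic_on S"
    by (intro holomorphic_intros)
  moreover have "(\<lambda>z. complex_of_real \<phi> * (z - of_real \<xi>0)) ` S \<subseteq> {s. Re s \<in> I}"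
    using phi by (auto simp: S_def I_def)
  ultimately have "(\<lambda>z. G (of_real \<phi> * (z - of_real \<xi>0))) holomorphic_on S"
    by (auto intro: holomorphic_on_compose_gen[unfolded comp_def])
  moreover have "B holomorphic_on S"
    using B unfolding analytic_extension_def S_def by (blast intro: analytic_imp_holomorphic)
  ultimately have hol: "(\<lambda>z. G (of_real \<phi> * (z - of_real \<xi>0))
      - exp (of_real \<phi> * (B z - B (of_real \<xi>0)))) holomorphic_on S"
    by (intro holomorphic_intros)
  \<comment> \<open>As a preimage under the linear continuous map \<open>Re\<close>, the strip
    inherits openness and convexity from \<open>\<Theta>\<close>; convexity yields
    connectedness.\<close>
  have "S = Re -` \<Theta>" by (auto simp: S_def)
  then have "open S" "connected S"
    using Theta_open_interval
    by (auto intro!: open_vimage continuous_intros convex_connected convex_linear_vimage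
        simp: is_interval_convex bounded_linear.linear[OF bounded_linear_Re])
  have xi0: "\<xi>0 \<in> \<Theta>" using Theta_left by auto
  \<comment> \<open>The point is approached from the left, where \<open>\<Theta>\<close> contains
    the whole half-line.\<close>
  have limit_point: "complex_of_real \<xi>0 islimpt complex_of_real ` \<Theta>"
    unfolding islimpt_approachable
  proof (intro allI impI)
    fix e :: real assume "0 < e"
    moreover from this have "\<xi>0 - e / 2 \<in> \<Theta>" using Theta_left by auto
    ultimately show "\<exists>x'\<in>complex_of_real ` \<Theta>. x' \<noteq> of_real \<xi>0 \<and> dist x' (of_real \<xi>0) < e"
      by (intro bexI[of _ "complex_of_real (\<xi>0 - e / 2)"])
        (auto simp: dist_norm simp flip: of_real_diff of_real_divide)
  qed
  have real_line: "G (of_real \<phi> * (x - of_real \<xi>0)) - exp (of_real \<phi> * (B x - B (of_real \<xi>0))) = 0"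
    if "x \<in> complex_of_real ` \<Theta>" for x
  proof -
    from that obtain \<theta> where \<theta>: "\<theta> \<in> \<Theta>" "x = of_real \<theta>" by auto
    have "G (of_real \<phi> * (x - of_real \<xi>0))
        = (CLINT w|m. complex_of_real (exp (\<phi> * (\<theta> - \<xi>0) * w)))"
      by (simp add: G_def \<theta> flip: exp_of_real)
    also have "\<dots> = of_real (exp (\<phi> * (b \<theta> - b \<xi>0)))"
      by (subst integral_complex_of_real) (simp add: has_bochner_integral_integral_eq[OF real_mgf[OF \<theta>(1)]])
    finally show ?thesis
      using B \<theta> xi0 by (simp add: analytic_extension_def flip: exp_of_real)
  qed
  have "complex_of_real ` \<Theta> \<subseteq> S" "of_real \<xi>0 \<in> S" "z \<in> S"
    using xi0 z by (auto simp: S_def)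
  from analytic_continuation[OF hol \<open>open S\<close> \<open>connected S\<close> this(1,2) limit_point real_line this(3)]
  show ?thesis by (simp add: G_def m_def)
qed

end

section \<open>Characteristic function of the normal mean-variance mixture\<close>

text \<open>Independence turns the joint law into a product, so Fubini allows integrating over
  \<open>Z\<close> first. For fixed \<open>w\<close> the mixture is normal with mean
  \<open>\<mu> * w\<close> and variance \<open>\<sigma>\<^sup>2 * w\<close>, so its characteristic
  function is an exponential linear in \<open>w\<close>.\<close>

lemma (in prob_space) char_normal_mean_variance_mixture:
  fixes W Z :: "'a \<Rightarrow> real" and \<mu> \<sigma> t :: real
  assumes pos: "AE x in M. 0 \<le> W x"
    and Z: "distributed M lborel Z std_normal_density"
    and indep: "indep_var borel W borel Z"
  shows "char (distr M borel (\<lambda>x. \<mu> * W x + \<sigma> * sqrt (W x) * Z x)) t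
       = (CLINT w|distr M borel W.
            exp ((\<i> * of_real t * of_real \<mu> - of_real (t\<^sup>2 * \<sigma>\<^sup>2 / 2)) * of_real w))"
proof -
  have W_rv[measurable]: "random_variable borel W" and Z_rv[measurable]: "random_variable borel Z"
    and joint: "distr M borel W \<Otimes>\<^sub>M distr M borel Z
      = distr M (borel \<Otimes>\<^sub>M borel) (\<lambda>x. (W x, Z x))"
    using indep unfolding indep_var_distribution_eq by auto
  interpret dW: prob_space "distr M borel W" by (rule prob_space_distr) simp
  interpret dZ: prob_space "distr M borel Z" by (rule prob_space_distr) simp
  interpret P: pair_prob_space "distr M borel W" "distr M borel Z" ..
  have distr_Z: "distr M borel Z = std_normal_distribution"
    using distributed_distr_eq_density[OF Z] by (simp cong: distr_cong)
  let ?f = "\<lambda>w z. iexp (t * (\<mu> * w + \<sigma> * sqrt w * z))"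
  have "char (distr M borel (\<lambda>x. \<mu> * W x + \<sigma> * sqrt (W x) * Z x)) t
      = (CLINT x|M. ?f (W x) (Z x))"
    unfolding char_def by (subst integral_distr) auto
  also have "\<dots> = (CLINT p|distr M borel W \<Otimes>\<^sub>M distr M borel Z. case_prod ?f p)"
    unfolding joint by (subst integral_distr) auto
  also have "\<dots> = (CLINT w|distr M borel W. CLINT z|distr M borel Z. ?f w z)"
  proof (rule P.integral_fst[symmetric])
    show "integrable (distr M borel W \<Otimes>\<^sub>M distr M borel Z) (case_prod ?f)"
      by (rule P.integrable_const_bound[where B = 1]) (auto simp: case_prod_beta)
  qed
  also have "\<dots> = (CLINT w|distr M borel W.
            exp ((\<i> * of_real t * of_real \<mu> - of_real (t\<^sup>2 * \<sigma>\<^sup>2 / 2)) * of_real w))"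
  proof (rule integral_cong_AE)
    have "AE w in distr M borel W. 0 \<le> w"
      using pos by (subst AE_distr_iff) auto
    then show "AE w in distr M borel W. (CLINT z|distr M borel Z. ?f w z)
        = exp ((\<i> * of_real t * of_real \<mu> - of_real (t\<^sup>2 * \<sigma>\<^sup>2 / 2)) * of_real w)"
    proof eventually_elim
      fix w :: real assume w: "0 \<le> w"
      have "(CLINT z|distr M borel Z. ?f w z)
          = (CLINT z|distr M borel Z. iexp (t * \<mu> * w) * iexp (t * \<sigma> * sqrt w * z))"
        by (intro Bochner_Integration.integral_cong refl)
          (simp add: algebra_simps flip: exp_add)
      also have "\<dots> = iexp (t * \<mu> * w) * char std_normal_distribution (t * \<sigma> * sqrt w)"
        by (simp add: char_def distr_Z)
      \<comment> \<open>Here \<open>0 \<le> w\<close> enters: it makes the square of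
        \<open>sqrt w\<close> equal to \<open>w\<close>.\<close>
      also have "\<dots> = exp ((\<i> * of_real t * of_real \<mu> - of_real (t\<^sup>2 * \<sigma>\<^sup>2 / 2)) * of_real w)"
        using w by (simp add: char_std_normal_distribution power_mult_distrib algebra_simps
            flip: exp_add exp_of_real of_real_power)
      finally show "(CLINT z|distr M borel Z. ?f w z)
        = exp ((\<i> * of_real t * of_real \<mu> - of_real (t\<^sup>2 * \<sigma>\<^sup>2 / 2)) * of_real w)" .
    qed
  qed measurable
  finally show ?thesis .
qed

section \<open>Identification of the law through its characteristic function\<close>

theorem proposition3p1:
  fixes \<nu> :: "real measure" and b :: "real \<Rightarrow> real" and c :: "real \<Rightarrow> real \<Rightarrow> real"
    and \<Theta> :: "real set" and \<xi>0 :: real and B :: "complex \<Rightarrow> complex"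
    and \<phi> \<mu> \<sigma> :: real
    and M :: "'a measure" and Y :: "'a \<Rightarrow> real"
    and N :: "'b measure" and W Z :: "'b \<Rightarrow> real"
  assumes EF: "EF_family \<nu> b c \<Theta> \<xi>0"
    and B: "analytic_extension b \<Theta> B"
    and phi: "\<phi> > 0" and sigma: "\<sigma> > 0"
    and M: "prob_space M" and Y: "Y \<in> borel_measurable M"
    and char_Y: "\<And>t. char (distr M borel Y) t =
      exp (- complex_of_real \<phi> *
        (B (complex_of_real \<xi>0)
         - B (complex_of_real \<xi>0
              + (\<i> * complex_of_real t * complex_of_real \<mu>
                 - complex_of_real (t\<^sup>2 * \<sigma>\<^sup>2 / 2)) / complex_of_real \<phi>)))"
    and N: "prob_space N"
    and W: "EF_distributed N W \<nu> b c \<xi>0 \<phi>"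
    and Z: "distributed N lborel Z std_normal_density"
    and indep: "prob_space.indep_var N borel W borel Z"
  shows "distr M borel Y = distr N borel (\<lambda>x. \<mu> * W x + \<sigma> * sqrt (W x) * Z x)"
proof -
  interpret EF_family \<nu> b c \<Theta> \<xi>0 by (rule EF)
  interpret M: prob_space M by (rule M)
  interpret N: prob_space N by (rule N)
  let ?X = "\<lambda>x. \<mu> * W x + \<sigma> * sqrt (W x) * Z x"
  have [measurable]: "W \<in> borel_measurable N" "Z \<in> borel_measurable N"
    using indep unfolding N.indep_var_distribution_eq by auto
  have W_pos: "AE x in N. 0 \<le> W x"
    and W_dist: "distributed N \<nu> W (\<lambda>w. ennreal (EF_density b c \<phi> \<xi>0 w))"
    using W unfolding EF_distributed_def by auto
  have distr_W: "distr N borel W = density \<nu> (\<lambda>w. ennreal (EF_density b c \<phi> \<xi>0 w))"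
    using distributed_distr_eq_density[OF W_dist] sets_nu by (simp cong: distr_cong)
  have "char (distr M borel Y) t = char (distr N borel ?X) t" for t
  proof -
    define s where "s = \<i> * complex_of_real t * of_real \<mu> - of_real (t\<^sup>2 * \<sigma>\<^sup>2 / 2)"
    \<comment> \<open>The point is chosen so that \<open>\<phi> * (z - \<xi>0) = s\<close>, matching
      the exponent in \<open>complex_mgf_eq\<close>.\<close>
    define z where "z = complex_of_real \<xi>0 + s / of_real \<phi>"
    \<comment> \<open>The real part is
      \<open>\<xi>0 - t\<^sup>2 * \<sigma>\<^sup>2 / (2 * \<phi>)\<close>, which never exceeds
      \<open>\<xi>0\<close>, so the left half-line contained in \<open>\<Theta>\<close> suffices for
      every \<open>t\<close>.\<close>
    have "Re z \<in> \<Theta>"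
      using phi by (auto simp: z_def s_def intro!: subsetD[OF Theta_left])
    have s: "s = of_real \<phi> * (z - of_real \<xi>0)"
      using phi by (simp add: z_def)
    have "char (distr N borel ?X) t = (CLINT w|distr N borel W. exp (s * of_real w))"
      unfolding s_def by (rule N.char_normal_mean_variance_mixture[OF W_pos Z indep])
    also have "\<dots> = exp (of_real \<phi> * (B z - B (of_real \<xi>0)))"
      unfolding distr_W s by (rule complex_mgf_eq[OF B phi \<open>Re z \<in> \<Theta>\<close>])
    also have "\<dots> = char (distr M borel Y) t"
      unfolding char_Y z_def s_def by (simp add: algebra_simps)
    finally show ?thesis ..
  qed
  then show ?thesis
    by (intro Levy_uniqueness M.real_distribution_distr N.real_distribution_distr Y ext) simp_all
qed

end
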